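(* Let $\partial$ be a subdifferential and let $X$ be a real Banach space on which property (P2) (slope control) holds for $\partial$. Let $(f_n)_n$ be a sequence of lower semicontinuous functions $f_n:X\to\mathbb{R}\cup\{+\infty\}$ and $(\varphi_n)_n$ a sequence of convex Lipschitz functions $\varphi_n:X\to\mathbb{R}$ such that $(f_n+\varphi_n)_n$ is Wijsman convergent to a lower semicontinuous function $f:X\to\mathbb{R}\cup\{+\infty\}$ at a point $\bar z\in\operatorname{dom} f$. Then there are elements $(x_n,x_n^* )\in\partial f_n$ and $(y_n,y_n^* )\in\partial\varphi_n$ such that $x_n\to\bar z$, $y_n\to\bar z$, $f_n(x_n)+\varphi_n(y_n)\to f(\bar z)$ and $$\limsup_n\|x_n^*+y_n^*\|\le|\nabla f|(\bar z).$$
   Context: $\operatorname{LSC}(X)$ is the set of lower semicontinuous functions $X\to\mathbb{R}\cup\{+\infty\}$; $\operatorname{dom} f=\{x: f(x)<\infty\}$; $\operatorname{epi} f=\{(x,\alpha)\in X\times\mathbb{R}: f(x)\le\alpha\}$; $x_n\to_f z$ means $x_n\to z$ and $f(x_n)\to f(z)$. $B_\lambda(x)$ is the closed ball of radius $\lambda$ centered at $x$ (with $B_0(x)=\{x\}$). $X\times\mathbb{R}$ carries the max norm. For subsets $A,B$ of a normed space, $D(A,B)=\inf\{\|a-b\|: a\in A,\ b\in B\}$ (with $\inf\emptyset=+\infty$). Slope: for $x\in\operatorname{dom} f$, $|\nabla f|(x):=\limsup_{y\to x,\,y\ne x}\frac{(f(x)-f(y))^+}{\|x-y\|}$, where $\alpha^+=\max(0,\alpha)$.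 Wijsman convergence at a point: a sequence $(g_n)_n\subset\operatorname{LSC}(X)$ is Wijsman convergent to $f\in\operatorname{LSC}(X)$ at $x$ if there is $\lambda_x\in(0,+\infty]$ such that for all $\lambda\in[0,\lambda_x)$ and all $\alpha\in\mathbb{R}$: (i) there is a sequence $x_n\to x$ in $X$ with $g_n(x_n)\to f(x)$; (ii) $D(B_\lambda(x)\times\{\alpha\},\operatorname{epi} f)>0$ implies $\sup_{\delta>0}\liminf_n D(B_{\lambda+\delta}(x)\times\{\alpha\},\operatorname{epi} g_n)>0$. Subdifferential: an operator $\partial$ associating a set $\partial f(x)\subset X^*$ to any triplet $(X,f,x)$, where $X$ is a Banach space, $f\in\operatorname{LSC}(X)$ and $x\in X$, such that: (A1) if $f$ is convex near $x$, then $\partial f(x)=\{x^*\in X^*:\langle x^*,y-x\rangle+f(x)\le f(y)\ \ \forall y\in X\}$; (A2) if $F(x,y)=f(x)+g(y)$, then $\partial F(x,y)\subset\partial f(x)\times\partial g(y)$; (A3) for any $f$ and $x^*\in X^*$, $\partial(f+x^* )(x)=\partial f(x)+x^*$. We also write $\partial f=\{(x,x^* )\in X\times X^*: x^*\in\partial f(x)\}$ for the graph. Property (P2) on $X$: for any $f\in\operatorname{LSC}(X)$, any convex Lipschitz $\varphi:X\to\mathbb{R}$ and any $z\in\operatorname{dom} f$, there are sequences $((x_n,x_n^* ))_n\subset\partial f$ and $((y_n,y_n^* ))_n\subset\partial\varphi$ such that $x_n\to_f z$, $y_n\to z$ and $\limsup_n\|x_n^*+y_n^*\|\le|\nabla(f+\varphi)|(z)$.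 *)

theory Defs
  imports "HOL-Analysis.Analysis" "HOL-Algebra.Module"
begin

section \<open>Banach spaces with explicit carriers\<close>

text \<open>
  A subdifferential acts on all Banach spaces at once, and one of its axioms relates different
  spaces. Since one cannot quantify over types inside a formula, a Banach space is a record on a
  carrier set rather than a type of class \<open>banach\<close>. All carriers consist of elements of
  the type \<open>'p point\<close>, which is closed under pairing, so that products of spaces are again
  spaces over the same type. The parameter \<open>'p\<close> is arbitrary.
\<close>

datatype 'p point = Atom (atom: 'p) | Couple (left: "'p point") (right: "'p point")

text \<open>Module records inherit the ring fields \<open>mult\<close> and \<open>one\<close>, which have no meaning here.\<close>

record 'u nspace = "(real, 'u) module" +
  nrm :: "'u \<Rightarrow> real"

definition real_ring :: "real ring" where
  "real_ring = \<lparr>carrier = UNIV, mult = (*), one = 1, zero = 0, add = (+)\<rparr>"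

text \<open>The value 0 off the carrier makes \<open>ndist X\<close> nonnegative and symmetric everywhere, as
  the locale \<open>Metric_space\<close> requires.\<close>

definition ndist :: "'u nspace \<Rightarrow> 'u \<Rightarrow> 'u \<Rightarrow> real" where
  "ndist X x y = (if x \<in> carrier X \<and> y \<in> carrier X then nrm X (x \<ominus>\<^bsub>X\<^esub> y) else 0)"

definition ntop :: "'u nspace \<Rightarrow> 'u topology" where
  "ntop X = Metric_space.mtopology (carrier X) (ndist X)"

definition banach_space :: "'u nspace \<Rightarrow> bool" where
  "banach_space X \<longleftrightarrow>
     Module.module real_ring X \<and>
     (\<forall>x\<in>carrier X. 0 \<le> nrm X x \<and> (nrm X x = 0 \<longleftrightarrow> x = \<zero>\<^bsub>X\<^esub>)) \<and>
     (\<forall>c. \<forall>x\<in>carrier X. nrm X (c \<odot>\<^bsub>X\<^esub> x) = \<bar>c\<bar> * nrm X x) \<and>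
     (\<forall>x\<in>carrier X. \<forall>y\<in>carrier X. nrm X (x \<oplus>\<^bsub>X\<^esub> y) \<le> nrm X x + nrm X y) \<and>
     Metric_space.mcomplete (carrier X) (ndist X)"

definition prod_space :: "'p point nspace \<Rightarrow> 'p point nspace \<Rightarrow> 'p point nspace" where
  "prod_space X Y =
     \<lparr>carrier = {Couple x y | x y. x \<in> carrier X \<and> y \<in> carrier Y},
      mult = undefined, one = undefined,
      zero = Couple \<zero>\<^bsub>X\<^esub> \<zero>\<^bsub>Y\<^esub>,
      add = (\<lambda>p q. Couple (left p \<oplus>\<^bsub>X\<^esub> left q) (right p \<oplus>\<^bsub>Y\<^esub> right q)),
      smult = (\<lambda>c p. Couple (c \<odot>\<^bsub>X\<^esub> left p) (c \<odot>\<^bsub>Y\<^esub> right p)),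
      nrm = (\<lambda>p. max (nrm X (left p)) (nrm Y (right p)))\<rparr>"

text \<open>Functionals are extended by 0 off the carrier, so that equality of functions is equality in
  the dual space.\<close>

definition dual :: "'u nspace \<Rightarrow> ('u \<Rightarrow> real) set" where
  "dual X = {\<xi>.
     (\<forall>x\<in>carrier X. \<forall>y\<in>carrier X. \<xi> (x \<oplus>\<^bsub>X\<^esub> y) = \<xi> x + \<xi> y) \<and>
     (\<forall>c. \<forall>x\<in>carrier X. \<xi> (c \<odot>\<^bsub>X\<^esub> x) = c * \<xi> x) \<and>
     (\<exists>C. \<forall>x\<in>carrier X. \<bar>\<xi> x\<bar> \<le> C * nrm X x) \<and>
     (\<forall>x. x \<notin> carrier X \<longrightarrow> \<xi> x = 0)}"

definition dual_norm :: "'u nspace \<Rightarrow> ('u \<Rightarrow> real) \<Rightarrow> real" where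
  "dual_norm X \<xi> = Sup {\<bar>\<xi> x\<bar> | x. x \<in> carrier X \<and> nrm X x \<le> 1}"

text \<open>The canonical structure of a type of class \<open>banach\<close>; see \<open>banach_space_of_type\<close> below.\<close>

definition space_of_type :: "'a::banach point nspace" where
  "space_of_type =
     \<lparr>carrier = range Atom, mult = undefined, one = undefined, zero = Atom 0,
      add = (\<lambda>p q. Atom (atom p + atom q)),
      smult = (\<lambda>c p. Atom (c *\<^sub>R atom p)),
      nrm = (\<lambda>p. norm (atom p))\<rparr>"


section \<open>Functions on a Banach space\<close>

text \<open>Functions on \<open>X\<close> are extended by \<open>\<infinity>\<close> off the carrier, so that they are determined by their
  values on \<open>X\<close>, and domain and epigraph need no relativization.\<close>

definition LSC :: "'u nspace \<Rightarrow> ('u \<Rightarrow> ereal) set" where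
  "LSC X = {f.
     (\<forall>x\<in>carrier X. f x \<noteq> -\<infinity>) \<and> (\<forall>x. x \<notin> carrier X \<longrightarrow> f x = \<infinity>) \<and>
     (\<forall>a::real. openin (ntop X) {x \<in> carrier X. ereal a < f x})}"

definition ext :: "'u nspace \<Rightarrow> ('u \<Rightarrow> real) \<Rightarrow> 'u \<Rightarrow> ereal" where
  "ext X \<phi> = (\<lambda>x. if x \<in> carrier X then ereal (\<phi> x) else \<infinity>)"

definition edom :: "('u \<Rightarrow> ereal) \<Rightarrow> 'u set" where
  "edom f = {x. f x < \<infinity>}"

definition epi :: "('u \<Rightarrow> ereal) \<Rightarrow> ('u \<times> real) set" where
  "epi f = {(x, \<alpha>). f x \<le> ereal \<alpha>}"

definition convex_fun :: "'u nspace \<Rightarrow> ('u \<Rightarrow> ereal) \<Rightarrow> bool" where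
  "convex_fun X f \<longleftrightarrow>
     (\<forall>u\<in>carrier X. \<forall>v\<in>carrier X. \<forall>t\<in>{0..1}.
        f (((1 - t) \<odot>\<^bsub>X\<^esub> u) \<oplus>\<^bsub>X\<^esub> (t \<odot>\<^bsub>X\<^esub> v)) \<le> ereal (1 - t) * f u + ereal t * f v)"

definition convex_lipschitz :: "'u nspace \<Rightarrow> ('u \<Rightarrow> real) \<Rightarrow> bool" where
  "convex_lipschitz X \<phi> \<longleftrightarrow>
     convex_fun X (ext X \<phi>) \<and>
     (\<exists>L. \<forall>u\<in>carrier X. \<forall>v\<in>carrier X. \<bar>\<phi> u - \<phi> v\<bar> \<le> L * ndist X u v)"

text \<open>The outer maximum only matters when \<open>X\<close> is the zero space: the upper limit over the empty
  punctured neighbourhood is then \<open>-\<infinity>\<close> in \<open>ereal\<close>, whereas the slope, as an upper limit of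
  nonnegative quantities, is 0.\<close>

definition slope :: "'u nspace \<Rightarrow> ('u \<Rightarrow> ereal) \<Rightarrow> 'u \<Rightarrow> ereal" where
  "slope X f x =
     max 0 (Limsup (atin (ntop X) x) (\<lambda>y. max 0 (f x - f y) / ereal (ndist X x y)))"

text \<open>Distance in \<open>X \<times> \<real>\<close> with the max norm; it is \<open>\<infinity>\<close> if one of the sets is empty.\<close>

definition set_gap :: "'u nspace \<Rightarrow> ('u \<times> real) set \<Rightarrow> ('u \<times> real) set \<Rightarrow> ereal" where
  "set_gap X A B = (INF (a, \<alpha>)\<in>A. INF (b, \<beta>)\<in>B. ereal (max (ndist X a b) \<bar>\<alpha> - \<beta>\<bar>))"

definition nball :: "'u nspace \<Rightarrow> 'u \<Rightarrow> real \<Rightarrow> 'u set" where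
  "nball X x r = {y \<in> carrier X. ndist X x y \<le> r}"

definition wijsman_at ::
  "'u nspace \<Rightarrow> (nat \<Rightarrow> 'u \<Rightarrow> ereal) \<Rightarrow> ('u \<Rightarrow> ereal) \<Rightarrow> 'u \<Rightarrow> bool" where
  "wijsman_at X g f x \<longleftrightarrow>
     (\<exists>l::ereal. 0 < l \<and>
       (\<forall>r::real. \<forall>\<alpha>::real. 0 \<le> r \<and> ereal r < l \<longrightarrow>
          (\<exists>xs. limitin (ntop X) xs x sequentially \<and> (\<lambda>n. g n (xs n)) \<longlonglongrightarrow> f x) \<and>
          (0 < set_gap X (nball X x r \<times> {\<alpha>}) (epi f) \<longrightarrow>
           0 < (SUP \<delta>\<in>{0<..}.
                  liminf (\<lambda>n. set_gap X (nball X x (r + \<delta>) \<times> {\<alpha>}) (epi (g n)))))))"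


section \<open>Subdifferentials\<close>

type_synonym 'p subdiff_op =
  "'p point nspace \<Rightarrow> ('p point \<Rightarrow> ereal) \<Rightarrow> 'p point \<Rightarrow> ('p point \<Rightarrow> real) set"

definition prod_sum ::
  "'p point nspace \<Rightarrow> 'p point nspace \<Rightarrow> ('p point \<Rightarrow> ereal) \<Rightarrow> ('p point \<Rightarrow> ereal) \<Rightarrow>
     'p point \<Rightarrow> ereal" where
  "prod_sum X Y f g =
     (\<lambda>p. if p \<in> carrier (prod_space X Y) then f (left p) + g (right p) else \<infinity>)"

text \<open>
  The four clauses are: values in the dual; agreement with convex analysis; separable sums; linear
  perturbations. Two of them are assumed in a slightly weaker form than they are usually printed,
  because the printed form is contradictory.
  \<^item> The formula for convex functions is required for functions that are convex on \<open>X\<close>. For functions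
    merely convex near \<open>x\<close>, the same global formula is incompatible with slope control: if \<open>f\<close> is 0 on
    the open unit ball and -1 elsewhere, then \<open>f\<close> has slope 0 at 0, but the formula makes the
    subdifferential empty at all points near 0.
  \<^item> The inclusion for separable sums is required at points of the domain of the sum. If \<open>f\<close> is
    constantly \<open>\<infinity>\<close>, then so is the sum \<open>F\<close> of \<open>f\<close> and any \<open>g\<close>. The formula for convex functions
    gives \<open>F\<close> the whole dual as its subdifferential, and the inclusion at all points would do the same
    to every \<open>g\<close>.

  An element of the dual of \<open>X \<times> Y\<close> is identified with a pair of functionals.
\<close>

definition subdifferential :: "'p subdiff_op \<Rightarrow> bool" where
  "subdifferential D \<longleftrightarrow>
     (\<forall>X. banach_space X \<longrightarrow> (\<forall>f\<in>LSC X. \<forall>x\<in>carrier X. D X f x \<subseteq> dual X)) \<and>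
     (\<forall>X. banach_space X \<longrightarrow> (\<forall>f\<in>LSC X. \<forall>x\<in>carrier X. convex_fun X f \<longrightarrow>
        D X f x = {\<xi> \<in> dual X. \<forall>y\<in>carrier X. ereal (\<xi> (y \<ominus>\<^bsub>X\<^esub> x)) + f x \<le> f y})) \<and>
     (\<forall>X Y. banach_space X \<longrightarrow> banach_space Y \<longrightarrow>
        (\<forall>f\<in>LSC X. \<forall>g\<in>LSC Y. \<forall>x\<in>carrier X. \<forall>y\<in>carrier Y.
           Couple x y \<in> edom (prod_sum X Y f g) \<longrightarrow>
           (\<forall>\<zeta>\<in>D (prod_space X Y) (prod_sum X Y f g) (Couple x y).
              \<exists>\<xi>\<in>D X f x. \<exists>\<eta>\<in>D Y g y.
                \<forall>u\<in>carrier X. \<forall>v\<in>carrier Y. \<zeta> (Couple u v) = \<xi> u + \<eta> v))) \<and>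
     (\<forall>X. banach_space X \<longrightarrow> (\<forall>f\<in>LSC X. \<forall>x\<in>carrier X. \<forall>\<xi>\<in>dual X.
        D X (\<lambda>y. f y + ereal (\<xi> y)) x = {\<lambda>y. \<eta> y + \<xi> y | \<eta>. \<eta> \<in> D X f x}))"

definition subdiff_graph :: "'p subdiff_op \<Rightarrow> 'p point nspace \<Rightarrow> ('p point \<Rightarrow> ereal) \<Rightarrow>
    ('p point \<times> ('p point \<Rightarrow> real)) set" where
  "subdiff_graph D X f = {(x, \<xi>). x \<in> carrier X \<and> \<xi> \<in> D X f x}"

definition slope_control :: "'p subdiff_op \<Rightarrow> 'p point nspace \<Rightarrow> bool" where
  "slope_control D X \<longleftrightarrow>
     (\<forall>f\<in>LSC X. \<forall>\<phi>. convex_lipschitz X \<phi> \<longrightarrow> (\<forall>z\<in>edom f.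
        \<exists>x \<xi> y \<eta>.
          (\<forall>n. (x n, \<xi> n) \<in> subdiff_graph D X f) \<and> (\<forall>n. (y n, \<eta> n) \<in> subdiff_graph D X (ext X \<phi>)) \<and>
          limitin (ntop X) x z sequentially \<and> (\<lambda>n. f (x n)) \<longlonglongrightarrow> f z \<and>
          limitin (ntop X) y z sequentially \<and>
          limsup (\<lambda>n. ereal (dual_norm X (\<lambda>u. \<xi> n u + \<eta> n u)))
            \<le> slope X (\<lambda>u. f u + ext X \<phi> u) z))"


section \<open>The carrier-based notion covers the type class\<close>

lemma abelian_group_space_of_type: "abelian_group (space_of_type :: 'a::banach point nspace)"
proof (rule abelian_groupI)
  fix x :: "'a point"
  assume x: "x \<in> carrier space_of_type"
  show "\<exists>y\<in>carrier space_of_type. y \<oplus>\<^bsub>space_of_type\<^esub> x = \<zero>\<^bsub>space_of_type\<^esub>"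
    by (rule bexI[of _ "Atom (- atom x)"]) (auto simp: space_of_type_def)
qed (auto simp: space_of_type_def)

lemma module_space_of_type: "Module.module real_ring (space_of_type :: 'a::banach point nspace)"
proof (rule Module.moduleI)
  show "cring real_ring"
  proof (rule cringI)
    show "abelian_group real_ring"
      by (rule abelian_groupI) (auto simp: real_ring_def intro: exI[of _ "- _"])
    show "comm_monoid real_ring"
      by (rule comm_monoidI) (auto simp: real_ring_def)
  qed (auto simp: real_ring_def algebra_simps)
qed (rule abelian_group_space_of_type,
     auto simp: space_of_type_def real_ring_def algebra_simps)

lemma ndist_space_of_type:
  "ndist (space_of_type :: 'a::banach point nspace) (Atom x) (Atom y) = dist x y"
proof -
  interpret abelian_group "space_of_type :: 'a point nspace"
    by (rule abelian_group_space_of_type)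
  have "\<ominus>\<^bsub>space_of_type\<^esub> (Atom y) = Atom (- y)"
    by (rule minus_equality) (auto simp: space_of_type_def)
  then show ?thesis
    by (simp add: ndist_def a_minus_def) (simp add: space_of_type_def dist_norm)
qed

lemma banach_space_of_type: "banach_space (space_of_type :: 'a::banach point nspace)"
proof -
  let ?X = "space_of_type :: 'a point nspace"
  have car: "carrier ?X = range Atom"
    by (simp add: space_of_type_def)
  interpret M: Metric_space "carrier ?X" "ndist ?X"
  proof
    fix x y z :: "'a point"
    show "0 \<le> ndist ?X x y"
    proof (cases "x \<in> carrier ?X \<and> y \<in> carrier ?X")
      case True
      then show ?thesis unfolding car by (auto simp only: ndist_space_of_type zero_le_dist)
    qed (simp only: ndist_def if_False order_refl)
    show "ndist ?X x y = ndist ?X y x"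
    proof (cases "x \<in> carrier ?X \<and> y \<in> carrier ?X")
      case True
      then show ?thesis unfolding car by (auto simp only: ndist_space_of_type dist_commute)
    next
      case False
      then show ?thesis unfolding ndist_def by metis
    qed
    assume xy: "x \<in> carrier ?X" "y \<in> carrier ?X"
    then show "ndist ?X x y = 0 \<longleftrightarrow> x = y"
      unfolding car by (auto simp only: ndist_space_of_type dist_eq_0_iff point.inject)
    assume "z \<in> carrier ?X"
    with xy show "ndist ?X x z \<le> ndist ?X x y + ndist ?X y z"
      unfolding car by (auto simp only: ndist_space_of_type dist_triangle)
  qed
  have "M.mcomplete"
    unfolding M.mcomplete_def
  proof (intro allI impI)
    fix s assume s: "M.MCauchy s"
    then have "range s \<subseteq> range Atom"
      by (simp add: M.MCauchy_def flip: car)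
    then have "\<forall>n. \<exists>a. s n = Atom a"
      by (meson rangeE rangeI subsetD)
    then obtain t where t: "s = (\<lambda>n. Atom (t n))"
      by (auto simp: choice_iff)
    have "Cauchy t"
      using s by (simp add: M.MCauchy_def t Cauchy_def ndist_space_of_type)
    then obtain l where "t \<longlonglongrightarrow> l"
      by (meson Cauchy_convergent convergentD)
    then have "\<forall>e>0. \<forall>\<^sub>F n in sequentially. s n \<in> carrier ?X \<and> ndist ?X (s n) (Atom l) < e"
      by (simp add: t tendsto_iff ndist_space_of_type car)
    then have "limitin M.mtopology s (Atom l) sequentially"
      unfolding M.limitin_metric by (simp add: car)
    then show "\<exists>x. limitin M.mtopology s x sequentially" ..
  qed
  then show ?thesis
    unfolding banach_space_def
    by (intro conjI module_space_of_type) (auto simp: space_of_type_def norm_triangle_ineq)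
qed

end

theory Submission
  imports Defs
begin

text \<open>
  Write \<open>g n = fs n + \<phi> n\<close> and \<open>a = f z\<close>, and let \<open>\<sigma>\<close> be the slope of \<open>f\<close> at \<open>z\<close>. Slope control
  turns a point of small slope of \<open>g n\<close> into a pair of subgradients with small sum, so the task is to
  find, for large \<open>n\<close>, points \<open>w\<close> near \<open>z\<close> at which \<open>g n w\<close> is near \<open>a\<close> and the slope of \<open>g n\<close> is at
  most \<open>\<sigma> + \<epsilon>\<close> (\<open>wijsman_low_slope_points\<close>).

  If \<open>\<sigma> = \<infinity>\<close>, the recovery sequence given by Wijsman convergence consists of such points. If
  \<open>\<sigma>\<close> is finite and \<open>s > \<sigma>\<close>, then \<open>f\<close> lies above the cone \<open>a - s * dist z y\<close> near \<open>z\<close>. The distance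
  condition of Wijsman convergence transfers a constant lower bound of \<open>f\<close> on a ball around \<open>z\<close> to
  \<open>g n\<close>. A cone is approximated uniformly from below by functions that are constant on finitely many
  concentric shells, so the cone bound passes to \<open>g n\<close> up to an error \<open>\<eta>\<close>
  (\<open>wijsman_linear_minorant\<close>). The recovery sequence shows that the bound is almost attained near
  \<open>z\<close>. Ekeland's principle, applied to \<open>g n\<close> on a ball with a constant \<open>s + \<tau>\<close> that exceeds \<open>s\<close>,
  then gives a point \<open>w\<close> of slope at most \<open>s + \<tau>\<close>. Because \<open>s + \<tau>\<close> is steeper than the cone, \<open>w\<close>
  cannot escape to the boundary of the ball (\<open>low_slope_point_of_linear_minorant\<close>).

  It remains to choose the precision \<open>\<epsilon>\<close> as a function of \<open>n\<close> (\<open>diagonal_selection\<close>). For the finitely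
  many \<open>n\<close> at which no approximation is available yet, some pair of subgradients must still exist.
  If \<open>fs n\<close> is somewhere finite, slope control provides one; if it is constantly \<open>\<infinity>\<close>, it is convex
  and its subdifferential is the whole dual.
\<close>

section \<open>Ekeland's variational principle\<close>

text \<open>
  The sets \<open>S x\<close> of points reachable from \<open>x\<close> by a descent of rate at least \<open>\<kappa>\<close> are closed, and they
  shrink along the induced order: \<open>y \<in> S x\<close> implies \<open>S y \<subseteq> S x\<close>. A sequence that at each step almost
  minimizes \<open>g\<close> over the current set leaves only little descent, so the diameters tend to 0 and
  completeness yields a single common point \<open>w\<close>. It satisfies \<open>S w = {w}\<close>, which is the last conclusion.
\<close>

lemma (in Metric_space) ekeland:
  fixes g :: "'a \<Rightarrow> ereal"
  assumes complete: mcomplete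
    and lsc: "\<And>t::real. openin mtopology {x \<in> M. ereal t < g x}"
    and below: "\<And>x. x \<in> M \<Longrightarrow> ereal b \<le> g x"
    and x0: "x0 \<in> M" "g x0 < \<infinity>"
    and \<kappa>: "0 < \<kappa>"
  obtains w where "w \<in> M" "g w + ereal (\<kappa> * d x0 w) \<le> g x0"
    "\<And>y. y \<in> M \<Longrightarrow> g w \<le> g y + ereal (\<kappa> * d w y)"
proof -
  define S where "S x = {y \<in> M. g y + ereal (\<kappa> * d x y) \<le> g x}" for x
  define P where "P x \<longleftrightarrow> x \<in> M \<and> g x < \<infinity>" for x
  have fin: "\<exists>c. g x = ereal c" if "P x" for x
    using that below[of x] unfolding P_def by (cases "g x") auto
  have self: "x \<in> S x" if "P x" for x
    using that by (simp add: S_def P_def zero_ereal_def[symmetric])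
  have sub: "P y" "S y \<subseteq> S x" if x: "P x" and y: "y \<in> S x" for x y
  proof -
    obtain c where c: "g x = ereal c" using fin[OF x] by blast
    show Py: "P y"
      using y c unfolding S_def P_def by (cases "g y") auto
    obtain c' where c': "g y = ereal c'" using fin[OF Py] by blast
    show "S y \<subseteq> S x"
    proof
      fix v assume v: "v \<in> S y"
      then have vM: "v \<in> M" by (simp add: S_def)
      have "d x v \<le> d x y + d y v"
        using x y vM by (intro triangle) (auto simp: P_def S_def)
      then have "\<kappa> * d x v \<le> \<kappa> * d x y + \<kappa> * d y v"
        using \<kappa> by (metis distrib_left mult_le_cancel_left_pos)
      then show "v \<in> S x"
        using v y c c' vM unfolding S_def by (cases "g v") auto
    qed
  qed
  have closed: "closedin mtopology (S x)" if x: "P x" for x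
    unfolding closedin_metric
  proof (intro conjI allI impI)
    show "S x \<subseteq> M" by (auto simp: S_def)
    fix y assume y: "y \<in> M - S x"
    obtain c where c: "g x = ereal c" using fin[OF x] by blast
    have "ereal (c - \<kappa> * d x y) < g y"
      using y c unfolding S_def by (cases "g y") auto
    then obtain t where t: "c - \<kappa> * d x y < t" "ereal t < g y"
      by (metis ereal_dense2 less_ereal.simps(1))
    have "y \<in> {v \<in> M. ereal t < g v}" using y t by simp
    then obtain r where r: "0 < r" "mball y r \<subseteq> {v \<in> M. ereal t < g v}"
      using lsc[of t] unfolding openin_mtopology by blast
    define r' where "r' = min r ((t - (c - \<kappa> * d x y)) / \<kappa>)"
    have "0 < r'" using r t \<kappa> by (simp add: r'_def)
    moreover have "v \<notin> S x" if v: "v \<in> mball y r'" for v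
    proof
      assume vS: "v \<in> S x"
      have "v \<in> mball y r" using v by (auto simp: r'_def)
      then have tv: "ereal t < g v" using r by blast
      have "d x y \<le> d x v + d v y"
        using x y v by (intro triangle) (auto simp: P_def)
      then have "\<kappa> * d x y \<le> \<kappa> * d x v + \<kappa> * d y v"
        using \<kappa> by (metis distrib_left mult_le_cancel_left_pos commute)
      moreover have "\<kappa> * d y v < t - (c - \<kappa> * d x y)"
        using v \<kappa> by (auto simp: r'_def pos_less_divide_eq mult.commute)
      ultimately show False
        using vS tv c unfolding S_def by (cases "g v") auto
    qed
    ultimately show "\<exists>r>0. disjnt (S x) (mball y r)"
      unfolding disjnt_def by blast
  qed
  have step: "\<exists>y\<in>S x. \<forall>v\<in>S x. g y \<le> g v + ereal e" if x: "P x" and e: "0 < e" for x e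
  proof -
    define m where "m = (INF v\<in>S x. g v)"
    have "ereal b \<le> m"
      unfolding m_def using below by (intro INF_greatest) (auto simp: S_def)
    moreover have "m \<le> g x"
      unfolding m_def by (rule INF_lower[OF self[OF x]])
    ultimately obtain m' where m': "m = ereal m'"
      using x by (cases m) (auto simp: P_def)
    then have "m < m + ereal e" using e by simp
    then obtain y where y: "y \<in> S x" "g y < m + ereal e"
      unfolding m_def INF_less_iff by blast
    have "g y \<le> g v + ereal e" if "v \<in> S x" for v
    proof -
      have "m \<le> g v" unfolding m_def by (rule INF_lower[OF that])
      then have "m + ereal e \<le> g v + ereal e" by (rule add_right_mono)
      with y show ?thesis by simp
    qed
    with y show ?thesis by blast
  qed
  have "\<exists>X. \<forall>k::nat. (P (X k) \<and> (k = 0 \<longrightarrow> X k = x0)) \<and>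
          (X (Suc k) \<in> S (X k) \<and> (\<forall>v\<in>S (X k). g (X (Suc k)) \<le> g v + ereal (1 / 2 ^ k)))"
  proof (rule dependent_nat_choice)
    show "\<exists>x. P x \<and> ((0::nat) = 0 \<longrightarrow> x = x0)" using x0 by (auto simp: P_def)
    fix x and k :: nat assume "P x \<and> (k = 0 \<longrightarrow> x = x0)"
    then have x: "P x" by simp
    obtain y where "y \<in> S x" "\<forall>v\<in>S x. g y \<le> g v + ereal (1 / 2 ^ k)"
      using step[OF x, of "1 / 2 ^ k"] by auto
    moreover from this have "P y" using sub(1)[OF x] by blast
    ultimately show "\<exists>y. (P y \<and> (Suc k = 0 \<longrightarrow> y = x0)) \<and>
        (y \<in> S x \<and> (\<forall>v\<in>S x. g y \<le> g v + ereal (1 / 2 ^ k)))"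
      by blast
  qed
  then obtain X where X: "\<And>k. P (X k)" "X 0 = x0" "\<And>k. X (Suc k) \<in> S (X k)"
    "\<And>k v. v \<in> S (X k) \<Longrightarrow> g (X (Suc k)) \<le> g v + ereal (1 / 2 ^ k)"
    by metis
  have small: "S (X (Suc k)) \<subseteq> mcball (X (Suc k)) (1 / 2 ^ k / \<kappa>)" for k
  proof
    fix v assume v: "v \<in> S (X (Suc k))"
    then have "v \<in> S (X k)" using sub[OF X(1) X(3)] by blast
    then have "g (X (Suc k)) \<le> g v + ereal (1 / 2 ^ k)" by (rule X(4))
    moreover obtain c where "g (X (Suc k)) = ereal c" using fin[OF X(1)] by blast
    ultimately have "\<kappa> * d (X (Suc k)) v \<le> 1 / 2 ^ k"
      using v unfolding S_def by (cases "g v") auto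
    then have "d (X (Suc k)) v \<le> 1 / 2 ^ k / \<kappa>"
      using \<kappa> by (metis pos_le_divide_eq mult.commute)
    then show "v \<in> mcball (X (Suc k)) (1 / 2 ^ k / \<kappa>)"
      using v X(1)[of "Suc k"] by (simp add: S_def P_def)
  qed
  have cover: "\<exists>n a. S (X n) \<subseteq> mcball a e" if "0 < e" for e
  proof -
    obtain k where "(1/2) ^ k < e * \<kappa>"
      using real_arch_pow_inv[of "e * \<kappa>" "1/2"] mult_pos_pos[OF \<open>0 < e\<close> \<kappa>] by auto
    then have "1 / 2 ^ k \<le> e * \<kappa>" by (simp add: power_one_over)
    then have "1 / 2 ^ k / \<kappa> \<le> e" using \<kappa> by (subst pos_divide_le_eq)
    then have "S (X (Suc k)) \<subseteq> mcball (X (Suc k)) e"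
      using small[of k] mcball_subset_concentric by blast
    then show ?thesis by blast
  qed
  have "\<exists>l. l \<in> M \<and> \<Inter> (range (\<lambda>k. S (X k))) = {l}"
  proof (rule complete[unfolded mcomplete_nest_sing, rule_format], intro conjI allI impI)
    show "decseq (\<lambda>k. S (X k))"
      using sub[OF X(1) X(3)] by (intro decseq_SucI) blast
    show "closedin mtopology (S (X k))" for k by (rule closed[OF X(1)])
    show "S (X k) \<noteq> {}" for k using self[OF X(1)] by blast
    show "\<exists>n a. S (X n) \<subseteq> mcball a e" if "0 < e" for e using cover[OF that] .
  qed
  then obtain w where w: "w \<in> M" "\<Inter> (range (\<lambda>k. S (X k))) = {w}" by blast
  then have wS: "w \<in> S (X k)" for k by blast
  have Pw: "P w" using sub[OF X(1) wS] by blast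
  have single: "v = w" if "v \<in> S w" for v
    using that w(2) sub(2)[OF X(1) wS] by blast
  show thesis
  proof
    show "w \<in> M" by fact
    show "g w + ereal (\<kappa> * d x0 w) \<le> g x0" using wS[of 0] X(2) by (simp add: S_def)
    fix y assume y: "y \<in> M"
    show "g w \<le> g y + ereal (\<kappa> * d w y)"
    proof (cases "y = w")
      case True
      then show ?thesis using y by (simp add: zero_ereal_def[symmetric])
    next
      case False
      then have "y \<notin> S w" using single by blast
      then show ?thesis using y by (simp add: S_def)
    qed
  qed
qed


section \<open>The metric of a normed space\<close>

lemma banach_space_metric:
  assumes "banach_space X"
  shows "Metric_space (carrier X) (ndist X)"
proof -
  interpret V: Module.module real_ring X
    using assms by (simp add: banach_space_def)
  have minus: "\<ominus>\<^bsub>real_ring\<^esub> (1::real) = -1"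
    by (rule V.R.minus_equality) (auto simp: real_ring_def)
  have sym: "nrm X (y \<ominus>\<^bsub>X\<^esub> x) = nrm X (x \<ominus>\<^bsub>X\<^esub> y)"
    if xy: "x \<in> carrier X" "y \<in> carrier X" for x y
  proof -
    have "y \<ominus>\<^bsub>X\<^esub> x = \<ominus>\<^bsub>X\<^esub> (x \<ominus>\<^bsub>X\<^esub> y)"
      using xy by (simp add: a_minus_def V.M.minus_add V.M.a_comm)
    also have "\<dots> = (-1) \<odot>\<^bsub>X\<^esub> (x \<ominus>\<^bsub>X\<^esub> y)"
      using V.smult_l_minus[of 1 "x \<ominus>\<^bsub>X\<^esub> y"] V.smult_one[of "x \<ominus>\<^bsub>X\<^esub> y"] xy minus
      by (simp add: real_ring_def)
    finally show ?thesis
      using assms xy by (simp add: banach_space_def)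
  qed
  have eq0: "x \<ominus>\<^bsub>X\<^esub> y = \<zero>\<^bsub>X\<^esub> \<longleftrightarrow> x = y" if "x \<in> carrier X" "y \<in> carrier X" for x y
    using that by (metis a_minus_def V.M.a_inv_closed V.M.minus_equality V.M.minus_minus V.M.r_neg)
  show ?thesis
  proof
    fix x y z
    show "0 \<le> ndist X x y"
      using assms by (simp add: ndist_def banach_space_def)
    show "ndist X x y = ndist X y x"
      using sym by (simp add: ndist_def)
    assume xy: "x \<in> carrier X" "y \<in> carrier X"
    then show "ndist X x y = 0 \<longleftrightarrow> x = y"
      using assms eq0 by (simp add: ndist_def banach_space_def)
    assume z: "z \<in> carrier X"
    have "x \<ominus>\<^bsub>X\<^esub> z = (x \<ominus>\<^bsub>X\<^esub> y) \<oplus>\<^bsub>X\<^esub> (y \<ominus>\<^bsub>X\<^esub> z)"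
      using xy z by (simp add: a_minus_def V.M.a_assoc V.M.r_neg1)
    then show "ndist X x z \<le> ndist X x y + ndist X y z"
      using assms xy z by (simp add: ndist_def banach_space_def)
  qed
qed

lemma limitin_ntop:
  assumes "banach_space X"
  shows "limitin (ntop X) xs x sequentially \<longleftrightarrow>
    x \<in> carrier X \<and> (\<forall>e>0. \<forall>\<^sub>F n in sequentially. xs n \<in> carrier X \<and> ndist X (xs n) x < e)"
proof -
  interpret M: Metric_space "carrier X" "ndist X" by (rule banach_space_metric[OF assms])
  show ?thesis by (simp add: ntop_def M.limitin_metric)
qed

lemma eventually_punctured_ntop:
  assumes "banach_space X" "z \<in> carrier X"
  shows "eventually Q (atin (ntop X) z) \<longleftrightarrow>
    (\<exists>r>0. \<forall>y\<in>carrier X. y \<noteq> z \<and> ndist X z y < r \<longrightarrow> Q y)"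
proof -
  interpret M: Metric_space "carrier X" "ndist X" by (rule banach_space_metric[OF assms(1)])
  have "eventually Q (atin (ntop X) z) \<longleftrightarrow>
      (\<exists>U. openin M.mtopology U \<and> z \<in> U \<and> (\<forall>y\<in>U - {z}. Q y))"
    using assms(2) by (simp add: ntop_def eventually_atin)
  also have "\<dots> \<longleftrightarrow> (\<exists>r>0. \<forall>y\<in>carrier X. y \<noteq> z \<and> ndist X z y < r \<longrightarrow> Q y)"
  proof (intro iffI; elim exE conjE)
    fix U assume "openin M.mtopology U" "z \<in> U" and Q: "\<forall>y\<in>U - {z}. Q y"
    then obtain r where "0 < r" "M.mball z r \<subseteq> U" unfolding M.openin_mtopology by blast
    with Q assms(2) show "\<exists>r>0. \<forall>y\<in>carrier X. y \<noteq> z \<and> ndist X z y < r \<longrightarrow> Q y"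
      by (intro exI[of _ r]) auto
  next
    fix r assume "0 < r" "\<forall>y\<in>carrier X. y \<noteq> z \<and> ndist X z y < r \<longrightarrow> Q y"
    then show "\<exists>U. openin M.mtopology U \<and> z \<in> U \<and> (\<forall>y\<in>U - {z}. Q y)"
      using assms(2) by (intro exI[of _ "M.mball z r"]) auto
  qed
  finally show ?thesis .
qed

lemma add_lipschitz_LSC:
  assumes X: "banach_space X" and f: "f \<in> LSC X" and \<phi>: "convex_lipschitz X \<phi>"
  shows "(\<lambda>u. f u + ext X \<phi> u) \<in> LSC X"
proof -
  interpret M: Metric_space "carrier X" "ndist X" by (rule banach_space_metric[OF X])
  obtain L where L: "\<And>u v. u \<in> carrier X \<Longrightarrow> v \<in> carrier X \<Longrightarrow> \<bar>\<phi> u - \<phi> v\<bar> \<le> L * ndist X u v"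
    using \<phi> unfolding convex_lipschitz_def by blast
  have ninf: "\<forall>x\<in>carrier X. f x \<noteq> -\<infinity>" and out: "\<forall>x. x \<notin> carrier X \<longrightarrow> f x = \<infinity>"
    and op: "\<And>t::real. openin M.mtopology {x \<in> carrier X. ereal t < f x}"
    using f by (auto simp: LSC_def ntop_def)
  have "openin M.mtopology {x \<in> carrier X. ereal a < f x + ext X \<phi> x}" for a
    unfolding M.openin_mtopology
  proof (intro conjI allI impI)
    fix x assume "x \<in> {x \<in> carrier X. ereal a < f x + ext X \<phi> x}"
    then have x: "x \<in> carrier X" "ereal a < f x + ext X \<phi> x" by auto
    then have "ereal (a - \<phi> x) < f x"
      by (cases "f x") (auto simp: ext_def)
    then obtain t where t: "a - \<phi> x < t" "ereal t < f x"
      by (metis ereal_dense2 less_ereal.simps(1))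
    have "x \<in> {y \<in> carrier X. ereal t < f y}" using x t by simp
    then obtain r where r: "0 < r" "M.mball x r \<subseteq> {y \<in> carrier X. ereal t < f y}"
      using op[of t] unfolding M.openin_mtopology by blast
    define r' where "r' = min r ((t - (a - \<phi> x)) / (\<bar>L\<bar> + 1))"
    have "0 < r'" using r t by (simp add: r'_def)
    moreover have "M.mball x r' \<subseteq> {x \<in> carrier X. ereal a < f x + ext X \<phi> x}"
    proof
      fix y assume "y \<in> M.mball x r'"
      then have y: "y \<in> carrier X" "ndist X x y < r" "ndist X x y < (t - (a - \<phi> x)) / (\<bar>L\<bar> + 1)"
        by (auto simp: r'_def)
      have "L * ndist X x y \<le> \<bar>L\<bar> * ndist X x y" by (intro mult_right_mono) auto
      also have "\<dots> \<le> ndist X x y * (\<bar>L\<bar> + 1)" by (simp add: algebra_simps)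
      also have "\<dots> < t - (a - \<phi> x)" using y(3) by (simp add: pos_less_divide_eq)
      finally have "a < t + \<phi> y" using L[OF x(1) y(1)] by linarith
      moreover have "ereal t < f y" using r(2) x y by auto
      ultimately show "y \<in> {x \<in> carrier X. ereal a < f x + ext X \<phi> x}"
        using y(1) by (cases "f y") (auto simp: ext_def)
    qed
    ultimately show "\<exists>r>0. M.mball x r \<subseteq> {x \<in> carrier X. ereal a < f x + ext X \<phi> x}" by blast
  qed auto
  then show ?thesis
    using ninf out by (auto simp: LSC_def ntop_def ext_def)
qed


section \<open>Slope bounds as linear minorants\<close>

text \<open>
  The two directions below translate between slopes and cone-shaped bounds, so that the limiting
  argument can be carried out with inequalities between functions.
\<close>

lemma linear_minorant_of_slope:
  assumes X: "banach_space X" and f: "f \<in> LSC X" and z: "z \<in> carrier X" "f z = ereal a"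
    and s: "slope X f z < ereal s"
  obtains r where "0 < r"
    "\<And>y. y \<in> carrier X \<Longrightarrow> ndist X z y < r \<Longrightarrow> ereal (a - s * ndist X z y) \<le> f y"
proof -
  interpret M: Metric_space "carrier X" "ndist X" by (rule banach_space_metric[OF X])
  have "Limsup (atin (ntop X) z) (\<lambda>y. max 0 (f z - f y) / ereal (ndist X z y)) < ereal s"
    using s unfolding slope_def by simp
  from Limsup_lessD[OF this] obtain r where r: "0 < r"
    "\<And>y. y \<in> carrier X \<Longrightarrow> y \<noteq> z \<Longrightarrow> ndist X z y < r \<Longrightarrow>
       max 0 (f z - f y) / ereal (ndist X z y) < ereal s"
    unfolding eventually_punctured_ntop[OF X z(1)] by blast
  have "ereal (a - s * ndist X z y) \<le> f y" if y: "y \<in> carrier X" "ndist X z y < r" for y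
  proof (cases "y = z")
    case True
    then show ?thesis using z by simp
  next
    case False
    then have d: "0 < ndist X z y" using y z by (metis M.nonneg M.zero less_eq_real_def)
    have "max 0 (f z - f y) / ereal (ndist X z y) < ereal s" using r(2) y False by blast
    then have "max 0 (f z - f y) < ereal s * ereal (ndist X z y)"
      using d by (subst (asm) ereal_divide_less_pos) (auto simp: mult.commute)
    then have "f z - f y < ereal (s * ndist X z y)" by simp
    then show ?thesis
      using z by (cases "f y") auto
  qed
  with r(1) show thesis by (rule that)
qed

lemma slope_le_of_linear_minorant:
  assumes X: "banach_space X" and w: "w \<in> carrier X" "g w = ereal c" and r: "0 < r" and s: "0 \<le> s"
    and minorant: "\<And>y. y \<in> carrier X \<Longrightarrow> ndist X w y < r \<Longrightarrow> g w \<le> g y + ereal (s * ndist X w y)"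
  shows "slope X g w \<le> ereal s"
proof -
  interpret M: Metric_space "carrier X" "ndist X" by (rule banach_space_metric[OF X])
  have "Limsup (atin (ntop X) w) (\<lambda>y. max 0 (g w - g y) / ereal (ndist X w y)) \<le> ereal s"
  proof (rule Limsup_bounded, unfold eventually_punctured_ntop[OF X w(1)],
      intro exI[of _ r] conjI ballI impI r)
    fix y assume y: "y \<in> carrier X" "y \<noteq> w \<and> ndist X w y < r"
    then have d: "0 < ndist X w y" using w by (metis M.nonneg M.zero less_eq_real_def)
    have "g w - g y \<le> ereal (s * ndist X w y)"
      using minorant[of y] y w by (cases "g y") auto
    then have "max 0 (g w - g y) \<le> ereal s * ereal (ndist X w y)"
      using s d by simp
    then show "max 0 (g w - g y) / ereal (ndist X w y) \<le> ereal s"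
      using d by (subst ereal_divide_le_pos) (auto simp: mult.commute)
  qed
  then show ?thesis using s by (simp add: slope_def)
qed


section \<open>Lower bounds and slopes under Wijsman convergence\<close>

text \<open>
  A constant lower bound \<open>\<alpha>\<close> on a ball passes from \<open>f\<close> to \<open>g n\<close>: if \<open>f\<close> exceeds \<open>\<alpha>\<close> by a margin on a
  slightly larger ball, then \<open>(ball) \<times> {\<alpha>}\<close> has positive distance from the epigraph of \<open>f\<close>, hence
  eventually from that of \<open>g n\<close>, and \<open>g n\<close> cannot be below \<open>\<alpha>\<close> on the ball. The cone bound follows by
  using this for finitely many radii: a point \<open>y\<close> is handled by the first radius of the grid that
  reaches it, at the cost of the drop of the cone over one mesh width. The radius \<open>\<rho>'\<close> does not
  depend on the error \<open>\<eta>\<close>, which lets \<open>\<eta>\<close> be chosen small relative to it.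
\<close>

lemma wijsman_linear_minorant:
  assumes X: "banach_space X" and f: "f \<in> LSC X" and z: "z \<in> carrier X"
    and W: "wijsman_at X g f z" and s: "0 \<le> s" and \<rho>: "0 < \<rho>"
    and minorant: "\<And>y. y \<in> carrier X \<Longrightarrow> ndist X z y < \<rho> \<Longrightarrow> ereal (a - s * ndist X z y) \<le> f y"
  obtains \<rho>' where "0 < \<rho>'"
    "\<And>\<eta>. 0 < \<eta> \<Longrightarrow> \<forall>\<^sub>F n in sequentially. \<forall>y\<in>carrier X. ndist X z y \<le> \<rho>' \<longrightarrow>
       ereal (a - s * ndist X z y - \<eta>) \<le> g n y"
proof -
  interpret M: Metric_space "carrier X" "ndist X" by (rule banach_space_metric[OF X])
  obtain l :: ereal where l: "0 < l"
    "\<And>r \<alpha>. 0 \<le> r \<Longrightarrow> ereal r < l \<Longrightarrow> 0 < set_gap X (nball X z r \<times> {\<alpha>}) (epi f) \<Longrightarrow>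
       0 < (SUP \<delta>\<in>{0<..}. liminf (\<lambda>n. set_gap X (nball X z (r + \<delta>) \<times> {\<alpha>}) (epi (g n))))"
    using W unfolding wijsman_at_def by blast
  obtain \<rho>' where \<rho>': "0 < \<rho>'" "\<rho>' < \<rho>" "ereal \<rho>' < l"
  proof -
    have "0 < min l (ereal \<rho>)" using l \<rho> by simp
    then obtain t where "0 < ereal t" "ereal t < min l (ereal \<rho>)"
      using ereal_dense2 by blast
    then show thesis by (intro that[of t]) auto
  qed
  have level: "\<forall>\<^sub>F n in sequentially. \<forall>y\<in>carrier X. ndist X z y \<le> r \<longrightarrow> ereal \<alpha> < g n y"
    if r: "0 \<le> r" "r \<le> \<rho>'" and \<alpha>: "\<alpha> < a - s * r" for r \<alpha>
  proof -
    \<comment> \<open>Moving by less than \<open>c\<close> away from the ball lowers the cone by at most \<open>s * c\<close>; the second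
      bound makes the rest of the margin at least \<open>c\<close>.\<close>
    define c where "c = min (\<rho> - \<rho>') ((a - s * r - \<alpha>) / (1 + s))"
    have c: "0 < c" using \<rho>' \<alpha> s by (simp add: c_def)
    have cs: "c + s * c \<le> a - s * r - \<alpha>"
    proof -
      have "c \<le> (a - s * r - \<alpha>) / (1 + s)" by (simp add: c_def)
      then have "c * (1 + s) \<le> a - s * r - \<alpha>" using s by (subst (asm) pos_le_divide_eq) auto
      then show ?thesis by (simp add: algebra_simps)
    qed
    have far: "c \<le> max (ndist X u b) \<bar>\<alpha> - \<beta>\<bar>"
      if u: "u \<in> nball X z r" and b: "(b, \<beta>) \<in> epi f" for u b \<beta>
    proof (rule ccontr)
      assume "\<not> ?thesis"
      then have near: "ndist X u b < c" "\<bar>\<alpha> - \<beta>\<bar> < c" by auto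
      have uX: "u \<in> carrier X" "ndist X z u \<le> r" using u by (auto simp: nball_def)
      have bX: "b \<in> carrier X" using b f by (auto simp: epi_def LSC_def)
      have zb: "ndist X z b \<le> r + c"
        using M.triangle[of z u b] z uX bX near by linarith
      have "ndist X z b < \<rho>"
        using M.triangle[of z u b] z uX bX near r by (simp add: c_def)
      then have "ereal (a - s * ndist X z b) \<le> ereal \<beta>"
        using order_trans[OF minorant[OF bX]] b unfolding epi_def by blast
      moreover have "s * ndist X z b \<le> s * r + s * c"
        using zb s by (metis distrib_left mult_left_mono)
      ultimately show False using near cs by simp
    qed
    have "ereal c \<le> set_gap X (nball X z r \<times> {\<alpha>}) (epi f)"
      unfolding set_gap_def
    proof (intro INF_greatest, unfold split_beta, intro INF_greatest)
      fix p q assume "p \<in> nball X z r \<times> {\<alpha>}" "q \<in> epi f"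
      then show "ereal c \<le> ereal (max (ndist X (fst p) (fst q)) \<bar>snd p - snd q\<bar>)"
        using far[of "fst p" "fst q" "snd q"] by (auto simp del: ereal_max simp: mem_Times_iff)
    qed
    then have "0 < set_gap X (nball X z r \<times> {\<alpha>}) (epi f)"
      using c by (metis ereal_less(2) less_le_trans)
    then have "0 < (SUP \<delta>\<in>{0<..}. liminf (\<lambda>n. set_gap X (nball X z (r + \<delta>) \<times> {\<alpha>}) (epi (g n))))"
      using r \<rho>' by (intro l(2)) (auto intro: le_less_trans[of _ "ereal \<rho>'"])
    then obtain \<delta> where \<delta>: "0 < \<delta>"
      "0 < liminf (\<lambda>n. set_gap X (nball X z (r + \<delta>) \<times> {\<alpha>}) (epi (g n)))"
      unfolding less_SUP_iff by auto
    from less_LiminfD[OF \<delta>(2)] show ?thesis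
    proof (rule eventually_mono, intro ballI impI)
      fix n y
      assume gap: "0 < set_gap X (nball X z (r + \<delta>) \<times> {\<alpha>}) (epi (g n))"
        and y: "y \<in> carrier X" "ndist X z y \<le> r"
      show "ereal \<alpha> < g n y"
      proof (rule ccontr)
        assume "\<not> ?thesis"
        then have "(y, \<alpha>) \<in> epi (g n)" by (simp add: epi_def)
        moreover have "(y, \<alpha>) \<in> nball X z (r + \<delta>) \<times> {\<alpha>}"
          using y \<delta> by (simp add: nball_def)
        ultimately have "set_gap X (nball X z (r + \<delta>) \<times> {\<alpha>}) (epi (g n))
            \<le> ereal (max (ndist X y y) \<bar>\<alpha> - \<alpha>\<bar>)"
          unfolding set_gap_def by (intro INF_lower2[of "(y, \<alpha>)"]) (auto intro!: INF_lower2[of "(y, \<alpha>)"])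
        with gap y show False by (simp add: zero_ereal_def[symmetric])
      qed
    qed
  qed
  have "\<forall>\<^sub>F n in sequentially. \<forall>y\<in>carrier X. ndist X z y \<le> \<rho>' \<longrightarrow>
      ereal (a - s * ndist X z y - \<eta>) \<le> g n y" if \<eta>: "0 < \<eta>" for \<eta>
  proof -
    obtain k' :: nat where k': "s * \<rho>' / \<eta> < real k'"
      using reals_Archimedean2 by blast
    define k where "k = Suc k'"
    have k: "0 < k" "s * \<rho>' / \<eta> < real k" using k' by (auto simp: k_def)
    \<comment> \<open>The mesh width \<open>h\<close> is so fine that the drop \<open>s * h\<close> of the cone over one mesh leaves the
      positive margin \<open>\<eta> - s * h\<close> that \<open>level\<close> requires.\<close>
    define h where "h = \<rho>' / k"
    have h: "0 < h" "s * h < \<eta>" "k * h = \<rho>'"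
      using k \<rho>' \<eta> by (auto simp: h_def field_simps)
    have "\<forall>\<^sub>F n in sequentially. \<forall>i\<in>{..k}. \<forall>y\<in>carrier X. ndist X z y \<le> i * h \<longrightarrow>
        ereal (a - s * (i * h) - (\<eta> - s * h)) < g n y"
    proof (rule eventually_ball_finite, simp, rule ballI, rule level)
      fix i assume "i \<in> {..k}"
      then have "i * h \<le> k * h" using h by (intro mult_right_mono) auto
      then show "i * h \<le> \<rho>'" using h by simp
    qed (use h in auto)
    then show ?thesis
    proof (rule eventually_mono, intro ballI impI)
      fix n y
      assume grid: "\<forall>i\<in>{..k}. \<forall>y\<in>carrier X. ndist X z y \<le> i * h \<longrightarrow>
          ereal (a - s * (i * h) - (\<eta> - s * h)) < g n y"
        and y: "y \<in> carrier X" "ndist X z y \<le> \<rho>'"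
      define i where "i = nat \<lceil>ndist X z y / h\<rceil>"
      have nn: "0 \<le> ndist X z y / h" using h by simp
      have i1: "ndist X z y / h \<le> i" unfolding i_def by linarith
      have i2: "i < ndist X z y / h + 1" unfolding i_def using nn by linarith
      have "ndist X z y / h \<le> k" using y h by (simp add: pos_divide_le_eq)
      then have "i \<le> k" unfolding i_def by linarith
      moreover have upper: "ndist X z y \<le> i * h" using i1 h by (simp add: pos_divide_le_eq)
      ultimately have "ereal (a - s * (i * h) - (\<eta> - s * h)) < g n y" using grid y by auto
      moreover have "i * h \<le> ndist X z y + h"
        using mult_strict_right_mono[OF i2 h(1)] h by (simp add: algebra_simps)
      then have "s * (i * h) \<le> s * ndist X z y + s * h"
        using s by (metis distrib_left mult_left_mono)
      then have "ereal (a - s * ndist X z y - \<eta>) \<le> ereal (a - s * (i * h) - (\<eta> - s * h))" by simp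
      ultimately show "ereal (a - s * ndist X z y - \<eta>) \<le> g n y"
        by (meson le_less_trans less_imp_le)
    qed
  qed
  with \<rho>'(1) show thesis by (rule that)
qed

text \<open>
  Ekeland's principle started at \<open>v\<close> with rate \<open>s + \<tau>\<close> gives \<open>w\<close> with
  \<open>g w \<le> a + \<eta> - (s + \<tau>) * dist v w\<close>, while the cone bound gives \<open>g w \<ge> a - s * dist z w - \<eta>\<close>.
  Comparing the two yields \<open>\<tau> * dist v w \<le> 2 * \<eta> + s * dist z v\<close>. Hence \<open>w\<close> lies in the open ball of
  radius \<open>R\<close>, and its minimality is a statement about all points near it, that is, about the slope.
\<close>

lemma low_slope_point_of_linear_minorant:
  assumes X: "banach_space X" and g: "g \<in> LSC X" and z: "z \<in> carrier X"
    and s: "0 \<le> s" and \<tau>: "0 < \<tau>" and R: "0 < R"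
    and minorant: "\<And>y. y \<in> carrier X \<Longrightarrow> ndist X z y \<le> R \<Longrightarrow> ereal (a - s * ndist X z y - \<eta>) \<le> g y"
    and v: "v \<in> carrier X" "g v \<le> ereal (a + \<eta>)"
    and near: "ndist X z v < R / 4" "s * ndist X z v < \<tau> * R / 8" "\<eta> \<le> \<tau> * R / 8"
  obtains w where "w \<in> carrier X" "ndist X z w < R" "g w \<le> ereal (a + \<eta>)"
    "slope X g w \<le> ereal (s + \<tau>)"
proof -
  interpret M: Metric_space "carrier X" "ndist X" by (rule banach_space_metric[OF X])
  have complete: "M.mcomplete" using X by (simp add: banach_space_def)
  \<comment> \<open>The value \<open>\<infinity>\<close> outside the closed ball confines the search to the region where the cone bound
    is known.\<close>
  define g' where "g' y = (if ndist X z y \<le> R then g y else \<infinity>)" for y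
  have g'v: "g' v = g v" using near R by (simp add: g'_def)
  have lsc: "openin M.mtopology {y \<in> carrier X. ereal t < g' y}" for t
  proof -
    have "{y \<in> carrier X. ereal t < g' y} = {y \<in> carrier X. ereal t < g y} \<union> (carrier X - M.mcball z R)"
      using z by (auto simp: g'_def)
    moreover have "openin M.mtopology {y \<in> carrier X. ereal t < g y}"
      using g by (simp add: LSC_def ntop_def)
    moreover have "openin M.mtopology (carrier X - M.mcball z R)"
      using M.closedin_mcball[of z R] unfolding closedin_def by simp
    ultimately show ?thesis by (simp add: openin_Un)
  qed
  have below: "ereal (a - s * R - \<eta>) \<le> g' y" if y: "y \<in> carrier X" for y
  proof (cases "ndist X z y \<le> R")
    case True
    then have "s * ndist X z y \<le> s * R" using s by (rule mult_left_mono)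
    then have "ereal (a - s * R - \<eta>) \<le> ereal (a - s * ndist X z y - \<eta>)" by simp
    also have "\<dots> \<le> g y" using minorant y True by blast
    finally show ?thesis using True by (simp add: g'_def)
  qed (simp add: g'_def)
  have "g' v < \<infinity>" using v(2) g'v by (auto intro: le_less_trans)
  then obtain w where w: "w \<in> carrier X" "g' w + ereal ((s + \<tau>) * ndist X v w) \<le> g' v"
    "\<And>y. y \<in> carrier X \<Longrightarrow> g' w \<le> g' y + ereal ((s + \<tau>) * ndist X w y)"
    using M.ekeland[OF complete lsc below v(1) _ add_nonneg_pos[OF s \<tau>]] by blast
  have le: "g' w + ereal ((s + \<tau>) * ndist X v w) \<le> ereal (a + \<eta>)"
    using w(2) v(2) g'v by simp
  then have wR: "ndist X z w \<le> R" by (auto simp: g'_def split: if_splits)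
  then have g'w: "g' w = g w" by (simp add: g'_def)
  obtain c where c: "g w = ereal c"
    using minorant[OF w(1) wR] le g'w by (cases "g w") auto
  have low: "a - s * ndist X z w - \<eta> \<le> c" using minorant[OF w(1) wR] c by simp
  have up: "c + (s + \<tau>) * ndist X v w \<le> a + \<eta>" using le g'w c by simp
  have tri: "ndist X z w \<le> ndist X z v + ndist X v w"
    using z v(1) w(1) by (rule M.triangle)
  then have "s * ndist X z w \<le> s * ndist X z v + s * ndist X v w"
    using s by (metis distrib_left mult_left_mono)
  then have "\<tau> * ndist X v w \<le> 2 * \<eta> + s * ndist X z v"
    using low up by (simp add: algebra_simps)
  moreover have "0 < \<tau> * R" using \<tau> R by simp
  ultimately have "\<tau> * ndist X v w < \<tau> * (R / 2)" using near by simp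
  then have "ndist X v w < R / 2" using \<tau> by simp
  then have zw: "ndist X z w < R" using tri near R by simp
  have "0 \<le> (s + \<tau>) * ndist X v w" using s \<tau> by simp
  then have gw: "g w \<le> ereal (a + \<eta>)" using up c by simp
  have "slope X g w \<le> ereal (s + \<tau>)"
  proof (rule slope_le_of_linear_minorant[where g = g, OF X w(1) c])
    show "0 < R - ndist X z w" using zw by simp
    show "0 \<le> s + \<tau>" using s \<tau> by simp
    fix y assume y: "y \<in> carrier X" "ndist X w y < R - ndist X z w"
    then have "ndist X z y \<le> R" using M.triangle[OF z w(1) y(1)] by simp
    then show "g w \<le> g y + ereal ((s + \<tau>) * ndist X w y)"
      using w(3)[OF y(1)] g'w by (simp add: g'_def)
  qed
  with w(1) zw gw show thesis by (rule that)
qed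

lemma wijsman_low_slope_points:
  assumes X: "banach_space X" and f: "f \<in> LSC X" and g: "\<And>n. g n \<in> LSC X"
    and z: "z \<in> carrier X" "f z = ereal a"
    and W: "wijsman_at X g f z" and \<epsilon>: "0 < \<epsilon>"
  shows "\<forall>\<^sub>F n in sequentially. \<exists>w\<in>carrier X. ndist X z w < \<epsilon> \<and>
    ereal (a - \<epsilon>) < g n w \<and> g n w < ereal (a + \<epsilon>) \<and> slope X (g n) w \<le> slope X f z + ereal \<epsilon>"
proof -
  interpret M: Metric_space "carrier X" "ndist X" by (rule banach_space_metric[OF X])
  obtain l :: ereal where "0 < l" "\<And>r::real. 0 \<le> r \<Longrightarrow> ereal r < l \<Longrightarrow>
       \<exists>xs. limitin (ntop X) xs z sequentially \<and> (\<lambda>n. g n (xs n)) \<longlonglongrightarrow> f z"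
    using W unfolding wijsman_at_def by blast
  from this(2)[of 0] this(1) obtain xs where
    xs: "limitin (ntop X) xs z sequentially" and gxs: "(\<lambda>n. g n (xs n)) \<longlonglongrightarrow> f z"
    by (auto simp: zero_ereal_def)
  have ev: "\<forall>\<^sub>F n in sequentially. xs n \<in> carrier X \<and> ndist X z (xs n) < \<theta> \<and>
      ereal (a - \<eta>) < g n (xs n) \<and> g n (xs n) < ereal (a + \<eta>)" if "0 < \<theta>" "0 < \<eta>" for \<theta> \<eta>
  proof -
    have "\<forall>\<^sub>F n in sequentially. xs n \<in> carrier X \<and> ndist X z (xs n) < \<theta>"
      using xs that unfolding limitin_ntop[OF X] by (auto simp: M.commute)
    moreover have "\<forall>\<^sub>F n in sequentially. ereal (a - \<eta>) < g n (xs n)"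
      using order_tendstoD(1)[OF gxs] z that by simp
    moreover have "\<forall>\<^sub>F n in sequentially. g n (xs n) < ereal (a + \<eta>)"
      using order_tendstoD(2)[OF gxs] z that by simp
    ultimately show ?thesis by eventually_elim simp
  qed
  have "0 \<le> slope X f z" by (simp add: slope_def)
  then consider "slope X f z = \<infinity>" | \<sigma> where "0 \<le> \<sigma>" "slope X f z = ereal \<sigma>"
    by (cases "slope X f z") auto
  then show ?thesis
  proof cases
    case 1
    from ev[OF \<epsilon> \<epsilon>] show ?thesis
      by (rule eventually_mono) (use 1 in auto)
  next
    case 2
    \<comment> \<open>Half of the allowed excess over \<open>\<sigma>\<close> makes the cone steeper than the slope of \<open>f\<close>, the other
      half is the excess of Ekeland's rate over the cone.\<close>
    define s where "s = \<sigma> + \<epsilon> / 2"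
    define \<tau> where "\<tau> = \<epsilon> / 2"
    have s: "0 \<le> s" "slope X f z < ereal s" using 2 \<epsilon> by (auto simp: s_def)
    have \<tau>: "0 < \<tau>" using \<epsilon> by (simp add: \<tau>_def)
    obtain \<rho> where \<rho>: "0 < \<rho>"
      "\<And>y. y \<in> carrier X \<Longrightarrow> ndist X z y < \<rho> \<Longrightarrow> ereal (a - s * ndist X z y) \<le> f y"
      using linear_minorant_of_slope[OF X f z s(2)] by blast
    obtain \<rho>' where \<rho>': "0 < \<rho>'"
      "\<And>\<eta>. 0 < \<eta> \<Longrightarrow> \<forall>\<^sub>F n in sequentially. \<forall>y\<in>carrier X. ndist X z y \<le> \<rho>' \<longrightarrow>
         ereal (a - s * ndist X z y - \<eta>) \<le> g n y"
      using wijsman_linear_minorant[OF X f z(1) W s(1) \<rho>] by blast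
    \<comment> \<open>Within distance \<open>R\<close> the cone drops by at most \<open>\<epsilon> / 2\<close>, which keeps the value at \<open>w\<close> near \<open>a\<close>.\<close>
    define R where "R = min \<rho>' (\<epsilon> / (2 * (s + 1)))"
    have R: "0 < R" using \<rho>' \<epsilon> s by (simp add: R_def)
    have "R \<le> \<epsilon> / (2 * (s + 1))" by (simp add: R_def)
    then have "R * (2 * (s + 1)) \<le> \<epsilon>" using s by (subst (asm) pos_le_divide_eq) auto
    then have "2 * (s * R) + 2 * R \<le> \<epsilon>" by (simp add: algebra_simps)
    then have sR: "s * R \<le> \<epsilon> / 2" "R < \<epsilon>" using R s mult_nonneg_nonneg[of s R] by linarith+
    define \<eta> where "\<eta> = min (\<epsilon> / 4) (\<tau> * R / 8)"
    have \<eta>: "0 < \<eta>" "\<eta> \<le> \<epsilon> / 4" "\<eta> \<le> \<tau> * R / 8" using \<epsilon> \<tau> R by (auto simp: \<eta>_def)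
    define \<theta> where "\<theta> = min (R / 4) (\<tau> * R / 8 / (s + 1))"
    have \<theta>: "0 < \<theta>" using \<tau> R s by (simp add: \<theta>_def)
    from ev[OF \<theta> \<eta>(1)] \<rho>'(2)[OF \<eta>(1)] show ?thesis
    proof eventually_elim
      case (elim n)
      have "ndist X z (xs n) < \<tau> * R / 8 / (s + 1)" using elim by (simp add: \<theta>_def)
      then have "ndist X z (xs n) * (s + 1) < \<tau> * R / 8"
        using s by (subst (asm) pos_less_divide_eq) auto
      then have close: "s * ndist X z (xs n) < \<tau> * R / 8"
        using M.nonneg[of z "xs n"] by (simp add: algebra_simps del: M.nonneg)
      obtain w where w: "w \<in> carrier X" "ndist X z w < R" "g n w \<le> ereal (a + \<eta>)"
        "slope X (g n) w \<le> ereal (s + \<tau>)"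
      proof (rule low_slope_point_of_linear_minorant[OF X g[of n] z(1) s(1) \<tau> R, of a \<eta> "xs n"])
        show "ereal (a - s * ndist X z y - \<eta>) \<le> g n y"
          if "y \<in> carrier X" "ndist X z y \<le> R" for y
          using elim that by (simp add: R_def)
      qed (use elim close \<eta> in \<open>auto simp: \<theta>_def\<close>)
      have "s * ndist X z w \<le> s * R" using w s by (intro mult_left_mono) auto
      then have "ereal (a - \<epsilon>) < ereal (a - s * ndist X z w - \<eta>)"
        using sR \<eta> \<epsilon> by simp
      also have "\<dots> \<le> g n w" using elim w by (simp add: R_def)
      finally have low: "ereal (a - \<epsilon>) < g n w" .
      have "g n w < ereal (a + \<epsilon>)" using w(3) \<eta> \<epsilon> by (intro le_less_trans[OF w(3)]) simp
      moreover have "slope X (g n) w \<le> slope X f z + ereal \<epsilon>"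
        using w(4) 2 by (simp add: s_def \<tau>_def add.commute)
      ultimately show ?case using w sR low by force
    qed
  qed
qed


section \<open>Passing to subgradients\<close>

definition subgradient_pairs ::
  "'p subdiff_op \<Rightarrow> 'p point nspace \<Rightarrow> ('p point \<Rightarrow> ereal) \<Rightarrow> ('p point \<Rightarrow> real) \<Rightarrow>
    (('p point \<times> ('p point \<Rightarrow> real)) \<times> ('p point \<times> ('p point \<Rightarrow> real))) set" where
  "subgradient_pairs D X f \<phi> = subdiff_graph D X f \<times> subdiff_graph D X (ext X \<phi>)"

text \<open>
  Slope control brings \<open>f (x n)\<close> close to \<open>f w\<close>, but makes no statement about \<open>\<phi> (y n)\<close>. The
  Lipschitz constant of \<open>\<phi>\<close> turns the closeness of \<open>y n\<close> to \<open>w\<close> into closeness of values. For a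
  sequence of functions \<open>\<phi>\<close> there need not be a common Lipschitz constant, and therefore this step is
  carried out for each function separately, with a prescribed precision.
\<close>

lemma slope_control_approx:
  assumes X: "banach_space X" and D: "slope_control D X"
    and f: "f \<in> LSC X" and \<phi>: "convex_lipschitz X \<phi>"
    and w: "w \<in> carrier X" "f w + ext X \<phi> w = ereal c"
    and s: "slope X (\<lambda>u. f u + ext X \<phi> u) w \<le> s" and \<epsilon>: "0 < \<epsilon>"
  obtains x \<xi> y \<eta> where "((x, \<xi>), (y, \<eta>)) \<in> subgradient_pairs D X f \<phi>"
    "ndist X w x < \<epsilon>" "ndist X w y < \<epsilon>"
    "ereal (c - \<epsilon>) < f x + ereal (\<phi> y)" "f x + ereal (\<phi> y) < ereal (c + \<epsilon>)"
    "ereal (dual_norm X (\<lambda>u. \<xi> u + \<eta> u)) \<le> s + ereal \<epsilon>"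
proof -
  interpret M: Metric_space "carrier X" "ndist X" by (rule banach_space_metric[OF X])
  obtain L where L: "\<And>u v. u \<in> carrier X \<Longrightarrow> v \<in> carrier X \<Longrightarrow> \<bar>\<phi> u - \<phi> v\<bar> \<le> L * ndist X u v"
    using \<phi> unfolding convex_lipschitz_def by blast
  have fw: "f w = ereal (c - \<phi> w)"
    using w by (cases "f w") (auto simp: ext_def)
  then have "w \<in> edom f" by (simp add: edom_def)
  then obtain x \<xi> y \<eta> where
    gr: "\<And>n. (x n, \<xi> n) \<in> subdiff_graph D X f" "\<And>n. (y n, \<eta> n) \<in> subdiff_graph D X (ext X \<phi>)"
    and x: "limitin (ntop X) x w sequentially" and fx: "(\<lambda>n. f (x n)) \<longlonglongrightarrow> f w"
    and y: "limitin (ntop X) y w sequentially"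
    and lim: "limsup (\<lambda>n. ereal (dual_norm X (\<lambda>u. \<xi> n u + \<eta> n u)))
        \<le> slope X (\<lambda>u. f u + ext X \<phi> u) w"
    using D f \<phi> unfolding slope_control_def by blast
  define \<theta> where "\<theta> = min \<epsilon> (\<epsilon> / 2 / (\<bar>L\<bar> + 1))"
  have \<theta>: "0 < \<theta>" using \<epsilon> by (simp add: \<theta>_def)
  have "\<forall>\<^sub>F n in sequentially. ndist X w (x n) < \<epsilon>"
    using x \<epsilon> unfolding limitin_ntop[OF X] by (auto simp: M.commute elim: eventually_mono)
  moreover have "\<forall>\<^sub>F n in sequentially. y n \<in> carrier X \<and> ndist X w (y n) < \<theta>"
    using y \<theta> unfolding limitin_ntop[OF X] by (auto simp: M.commute)
  moreover have "\<forall>\<^sub>F n in sequentially. ereal (c - \<phi> w - \<epsilon> / 2) < f (x n)"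
    using order_tendstoD(1)[OF fx] fw \<epsilon> by simp
  moreover have "\<forall>\<^sub>F n in sequentially. f (x n) < ereal (c - \<phi> w + \<epsilon> / 2)"
    using order_tendstoD(2)[OF fx] fw \<epsilon> by simp
  moreover have "\<forall>\<^sub>F n in sequentially. ereal (dual_norm X (\<lambda>u. \<xi> n u + \<eta> n u)) \<le> s + ereal \<epsilon>"
  proof (cases "s = \<infinity>")
    case False
    have "0 \<le> s" using s by (simp add: slope_def)
    with False have "s < s + ereal \<epsilon>" using \<epsilon> by (cases s) auto
    then have "limsup (\<lambda>n. ereal (dual_norm X (\<lambda>u. \<xi> n u + \<eta> n u))) < s + ereal \<epsilon>"
      using lim s by (meson le_less_trans order_trans)
    from Limsup_lessD[OF this] show ?thesis by (rule eventually_mono) simp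
  qed simp
  ultimately have "\<forall>\<^sub>F n in sequentially. ndist X w (x n) < \<epsilon> \<and>
      (y n \<in> carrier X \<and> ndist X w (y n) < \<theta>) \<and>
      ereal (c - \<phi> w - \<epsilon> / 2) < f (x n) \<and> f (x n) < ereal (c - \<phi> w + \<epsilon> / 2) \<and>
      ereal (dual_norm X (\<lambda>u. \<xi> n u + \<eta> n u)) \<le> s + ereal \<epsilon>"
    by eventually_elim simp
  then obtain n where n: "ndist X w (x n) < \<epsilon>" "y n \<in> carrier X" "ndist X w (y n) < \<theta>"
      "ereal (c - \<phi> w - \<epsilon> / 2) < f (x n)" "f (x n) < ereal (c - \<phi> w + \<epsilon> / 2)"
      "ereal (dual_norm X (\<lambda>u. \<xi> n u + \<eta> n u)) \<le> s + ereal \<epsilon>"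
    using eventually_happens by fastforce
  have "L * ndist X w (y n) \<le> \<bar>L\<bar> * ndist X w (y n)" by (intro mult_right_mono) auto
  also have "\<dots> \<le> ndist X w (y n) * (\<bar>L\<bar> + 1)" by (simp add: algebra_simps)
  also have "\<dots> < \<epsilon> / 2"
  proof -
    have "ndist X w (y n) < \<epsilon> / 2 / (\<bar>L\<bar> + 1)" using n(3) by (simp add: \<theta>_def)
    then show ?thesis by (subst (asm) pos_less_divide_eq) auto
  qed
  finally have "\<bar>\<phi> w - \<phi> (y n)\<bar> < \<epsilon> / 2" using L[OF w(1) n(2)] by linarith
  then have "c - \<epsilon> < (c - \<phi> w - \<epsilon> / 2) + \<phi> (y n)" "(c - \<phi> w + \<epsilon> / 2) + \<phi> (y n) < c + \<epsilon>"
    by linarith+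
  then have "ereal (c - \<epsilon>) < f (x n) + ereal (\<phi> (y n))" "f (x n) + ereal (\<phi> (y n)) < ereal (c + \<epsilon>)"
    using n(4,5) by (cases "f (x n)"; simp)+
  moreover have "((x n, \<xi> n), (y n, \<eta> n)) \<in> subgradient_pairs D X f \<phi>"
    using gr by (simp add: subgradient_pairs_def)
  moreover have "ndist X w (y n) < \<epsilon>" using n(3) by (simp add: \<theta>_def)
  ultimately show thesis using n by (intro that)
qed

text \<open>If \<open>f\<close> is constantly \<open>\<infinity>\<close>, slope control says nothing, but \<open>f\<close> is convex and every functional
  satisfies the subgradient inequality.\<close>

lemma subdiff_graph_nonempty:
  assumes X: "banach_space X" and D: "subdifferential D" "slope_control D X"
    and f: "f \<in> LSC X" and z: "z \<in> carrier X"
  shows "subdiff_graph D X f \<noteq> {}"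
proof (cases "edom f = {}")
  case True
  then have f_inf: "f = (\<lambda>_. \<infinity>)" by (auto simp: edom_def fun_eq_iff)
  have "ereal (1 - t) * \<infinity> + ereal t * \<infinity> = \<infinity>" if "t \<in> {0..1}" for t
    using that by (cases "t = 0") auto
  then have "convex_fun X f" unfolding convex_fun_def f_inf by simp
  then have "D X f z = {\<xi> \<in> dual X. \<forall>y\<in>carrier X. ereal (\<xi> (y \<ominus>\<^bsub>X\<^esub> z)) + f z \<le> f y}"
    using D(1) X f z unfolding subdifferential_def by blast
  moreover have "(\<lambda>_. 0) \<in> dual X"
    unfolding dual_def by (auto intro!: exI[of _ 0])
  ultimately have "(\<lambda>_. 0) \<in> D X f z" by (simp add: f_inf)
  with z show ?thesis by (auto simp: subdiff_graph_def)
next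
  case False
  have lip: "convex_lipschitz X (\<lambda>_. 0)"
    unfolding convex_lipschitz_def
  proof
    interpret V: Module.module real_ring X
      using X by (simp add: banach_space_def)
    show "convex_fun X (ext X (\<lambda>_. 0))"
      unfolding convex_fun_def using V.smult_closed
      by (auto simp: ext_def zero_ereal_def[symmetric] real_ring_def)
  qed (auto intro!: exI[of _ 0])
  obtain w where w: "w \<in> edom f" using False by blast
  obtain x \<xi> where "\<And>n::nat. (x n, \<xi> n) \<in> subdiff_graph D X f"
    using D(2)[unfolded slope_control_def, rule_format, OF f lip w] by blast
  then show ?thesis by blast
qed

text \<open>The graph of \<open>ext X \<phi>\<close> is covered by the previous lemma because \<open>ext X \<phi>\<close> is the sum of the
  zero function and \<open>\<phi>\<close>, hence lower semicontinuous.\<close>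

lemma subgradient_pairs_nonempty:
  assumes X: "banach_space X" and D: "subdifferential D" "slope_control D X"
    and f: "f \<in> LSC X" and \<phi>: "convex_lipschitz X \<phi>" and z: "z \<in> carrier X"
  shows "subgradient_pairs D X f \<phi> \<noteq> {}"
proof -
  interpret M: Metric_space "carrier X" "ndist X" by (rule banach_space_metric[OF X])
  define e where "e u = (if u \<in> carrier X then 0 else (\<infinity>::ereal))" for u
  have "{x \<in> carrier X. ereal t < e x} = (if t < 0 then carrier X else {})" for t
    by (auto simp: e_def)
  then have "e \<in> LSC X"
    using openin_topspace[of M.mtopology] by (auto simp: LSC_def ntop_def e_def)
  from add_lipschitz_LSC[OF X this \<phi>] have "ext X \<phi> \<in> LSC X"
    by (simp add: e_def ext_def fun_eq_iff if_distrib cong: if_cong)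
  with subdiff_graph_nonempty[OF X D _ z] f show ?thesis
    by (simp add: subgradient_pairs_def)
qed


section \<open>Choosing the precision along the sequence\<close>

text \<open>For each \<open>n\<close> one takes a witness for the largest level \<open>k \<le> n\<close> that has one; the bound
  \<open>k \<le> n\<close> guarantees that a largest level exists.\<close>

lemma diagonal_selection:
  fixes Q :: "nat \<Rightarrow> nat \<Rightarrow> 'b \<Rightarrow> bool"
  assumes base: "\<And>n. \<exists>q. Q 0 n q"
    and anti: "\<And>j k n q. j \<le> k \<Longrightarrow> Q k n q \<Longrightarrow> Q j n q"
    and ev: "\<And>k. \<forall>\<^sub>F n in sequentially. \<exists>q. Q k n q"
  obtains q where "\<And>k. \<forall>\<^sub>F n in sequentially. Q k n (q n)" "\<And>n. Q 0 n (q n)"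
proof -
  define K where "K n = {k. k \<le> n \<and> (\<exists>q. Q k n q)}" for n
  have K: "finite (K n)" "0 \<in> K n" for n
    using base by (auto simp: K_def)
  have "Max (K n) \<in> K n" for n using K by (intro Max_in) auto
  then have "\<forall>n. \<exists>q. Q (Max (K n)) n q" by (simp add: K_def)
  then obtain q where q: "\<And>n. Q (Max (K n)) n (q n)" by metis
  show thesis
  proof
    fix k
    from ev[of k] eventually_ge_at_top[of k] show "\<forall>\<^sub>F n in sequentially. Q k n (q n)"
    proof eventually_elim
      case (elim n)
      then have "k \<le> Max (K n)" using K by (intro Max_ge) (auto simp: K_def)
      then show ?case using q anti by blast
    qed
    show "Q 0 n (q n)" for n using q anti by blast
  qed
qed

theorem theorem6p2:
  fixes D :: "'p subdiff_op"
    and X :: "'p point nspace"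
    and fs :: "nat \<Rightarrow> 'p point \<Rightarrow> ereal"
    and \<phi> :: "nat \<Rightarrow> 'p point \<Rightarrow> real"
    and f :: "'p point \<Rightarrow> ereal"
    and z :: "'p point"
  assumes "subdifferential D"
    and "banach_space X"
    and "slope_control D X"
    and "\<And>n. fs n \<in> LSC X"
    and "\<And>n. convex_lipschitz X (\<phi> n)"
    and "f \<in> LSC X"
    and "z \<in> edom f"
    and "wijsman_at X (\<lambda>n u. fs n u + ext X (\<phi> n) u) f z"
  shows "\<exists>x \<xi> y \<eta>.
      (\<forall>n. (x n, \<xi> n) \<in> subdiff_graph D X (fs n)) \<and>
      (\<forall>n. (y n, \<eta> n) \<in> subdiff_graph D X (ext X (\<phi> n))) \<and>
      limitin (ntop X) x z sequentially \<and>
      limitin (ntop X) y z sequentially \<and>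
      (\<lambda>n. fs n (x n) + ereal (\<phi> n (y n))) \<longlonglongrightarrow> f z \<and>
      limsup (\<lambda>n. ereal (dual_norm X (\<lambda>u. \<xi> n u + \<eta> n u))) \<le> slope X f z"
proof -
  note X = assms(2)
  interpret M: Metric_space "carrier X" "ndist X" by (rule banach_space_metric[OF X])
  have z: "z \<in> carrier X" "f z < \<infinity>" "f z \<noteq> -\<infinity>"
    using assms(6,7) by (auto simp: LSC_def edom_def)
  then obtain a where a: "f z = ereal a" by (cases "f z") auto
  define good where "good \<epsilon> n q \<longleftrightarrow> (case q of ((x, \<xi>), (y, \<eta>)) \<Rightarrow>
      ndist X z x < \<epsilon> \<and> ndist X z y < \<epsilon> \<and>
      ereal (a - \<epsilon>) < fs n x + ereal (\<phi> n y) \<and> fs n x + ereal (\<phi> n y) < ereal (a + \<epsilon>) \<and>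
      ereal (dual_norm X (\<lambda>u. \<xi> u + \<eta> u)) \<le> slope X f z + ereal \<epsilon>)" for \<epsilon> n q
  have good_mono: "good \<epsilon>' n q" if "good \<epsilon> n q" "\<epsilon> \<le> \<epsilon>'" for \<epsilon> \<epsilon>' n q
  proof -
    obtain x \<xi> y \<eta> where q: "q = ((x, \<xi>), (y, \<eta>))" by (metis surj_pair)
    have "slope X f z + ereal \<epsilon> \<le> slope X f z + ereal \<epsilon>'"
      using that by (intro add_left_mono) simp
    moreover have "ereal (a - \<epsilon>') \<le> ereal (a - \<epsilon>)" "ereal (a + \<epsilon>) \<le> ereal (a + \<epsilon>')"
      using that by auto
    ultimately show ?thesis
      using that unfolding good_def q prod.case
      by (meson order_trans less_le_trans le_less_trans)
  qed
  have approx: "\<forall>\<^sub>F n in sequentially. \<exists>q\<in>subgradient_pairs D X (fs n) (\<phi> n). good \<epsilon> n q"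
    if \<epsilon>: "0 < \<epsilon>" for \<epsilon>
  proof -
    have half: "0 < \<epsilon> / 2" using \<epsilon> by simp
    have "\<forall>\<^sub>F n in sequentially. \<exists>w\<in>carrier X. ndist X z w < \<epsilon> / 2 \<and>
        ereal (a - \<epsilon> / 2) < fs n w + ext X (\<phi> n) w \<and> fs n w + ext X (\<phi> n) w < ereal (a + \<epsilon> / 2) \<and>
        slope X (\<lambda>u. fs n u + ext X (\<phi> n) u) w \<le> slope X f z + ereal (\<epsilon> / 2)"
      by (rule wijsman_low_slope_points[OF X assms(6) add_lipschitz_LSC[OF X assms(4,5)]
            z(1) a assms(8) half])
    then show ?thesis
    proof (rule eventually_mono, elim bexE conjE)
      fix n w
      assume w: "w \<in> carrier X" "ndist X z w < \<epsilon> / 2"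
        "ereal (a - \<epsilon> / 2) < fs n w + ext X (\<phi> n) w" "fs n w + ext X (\<phi> n) w < ereal (a + \<epsilon> / 2)"
        "slope X (\<lambda>u. fs n u + ext X (\<phi> n) u) w \<le> slope X f z + ereal (\<epsilon> / 2)"
      obtain c where c: "fs n w + ext X (\<phi> n) w = ereal c"
        using w(3,4) by (cases "fs n w + ext X (\<phi> n) w") auto
      obtain x \<xi> y \<eta> where q: "((x, \<xi>), (y, \<eta>)) \<in> subgradient_pairs D X (fs n) (\<phi> n)"
        "ndist X w x < \<epsilon> / 2" "ndist X w y < \<epsilon> / 2"
        "ereal (c - \<epsilon> / 2) < fs n x + ereal (\<phi> n y)" "fs n x + ereal (\<phi> n y) < ereal (c + \<epsilon> / 2)"
        "ereal (dual_norm X (\<lambda>u. \<xi> u + \<eta> u)) \<le> slope X f z + ereal (\<epsilon> / 2) + ereal (\<epsilon> / 2)"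
        by (rule slope_control_approx[OF X assms(3,4,5) w(1) c w(5) half])
      have xy: "x \<in> carrier X" "y \<in> carrier X"
        using q(1) by (auto simp: subgradient_pairs_def subdiff_graph_def)
      have "ndist X z x < \<epsilon>" "ndist X z y < \<epsilon>"
        using M.triangle[OF z(1) w(1) xy(1)] M.triangle[OF z(1) w(1) xy(2)] w(2) q(2,3) by linarith+
      moreover have "ereal (a - \<epsilon>) \<le> ereal (c - \<epsilon> / 2)" "ereal (c + \<epsilon> / 2) \<le> ereal (a + \<epsilon>)"
        using w(3,4) unfolding c by auto
      then have "ereal (a - \<epsilon>) < fs n x + ereal (\<phi> n y)" "fs n x + ereal (\<phi> n y) < ereal (a + \<epsilon>)"
        using q(4,5) by (meson less_le_trans le_less_trans)+
      ultimately have "good \<epsilon> n ((x, \<xi>), (y, \<eta>))"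
        using q(6) by (simp add: good_def add.assoc)
      with q(1) show "\<exists>q\<in>subgradient_pairs D X (fs n) (\<phi> n). good \<epsilon> n q" by blast
    qed
  qed
  have nonempty: "\<exists>q. q \<in> subgradient_pairs D X (fs n) (\<phi> n)" for n
    using subgradient_pairs_nonempty[OF X assms(1,3) assms(4)[of n] assms(5)[of n] z(1)] by blast
  \<comment> \<open>Level 0 demands only subgradients, so that the selected pairs are subgradients for every \<open>n\<close>.\<close>
  obtain q where q: "\<And>k. \<forall>\<^sub>F n in sequentially. 0 < k \<longrightarrow> good (1 / real k) n (q n)"
      "\<And>n. q n \<in> subgradient_pairs D X (fs n) (\<phi> n)"
  proof (rule diagonal_selection[where Q = "\<lambda>k n q. q \<in> subgradient_pairs D X (fs n) (\<phi> n) \<and>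
        (0 < k \<longrightarrow> good (1 / real k) n q)"])
    show "\<exists>q. q \<in> subgradient_pairs D X (fs n) (\<phi> n) \<and> (0 < (0::nat) \<longrightarrow> good (1 / real 0) n q)" for n
      using nonempty by simp
  next
    fix j k n :: nat and q
    assume "j \<le> k" "q \<in> subgradient_pairs D X (fs n) (\<phi> n) \<and> (0 < k \<longrightarrow> good (1 / real k) n q)"
    then show "q \<in> subgradient_pairs D X (fs n) (\<phi> n) \<and> (0 < j \<longrightarrow> good (1 / real j) n q)"
      using good_mono[of "1 / real k" n q "1 / real j"] by (auto simp: frac_le)
  next
    fix k :: nat
    show "\<forall>\<^sub>F n in sequentially. \<exists>q. q \<in> subgradient_pairs D X (fs n) (\<phi> n) \<and>
        (0 < k \<longrightarrow> good (1 / real k) n q)"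
    proof (cases "k = 0")
      case True
      then show ?thesis
        using nonempty by simp
    next
      case False
      then have "0 < 1 / real k" by simp
      from approx[OF this] show ?thesis by (rule eventually_mono) blast
    qed
  qed (auto elim: eventually_mono)
  have ev: "\<forall>\<^sub>F n in sequentially. good \<epsilon> n (q n)" if \<epsilon>: "0 < \<epsilon>" for \<epsilon>
  proof -
    obtain k where k: "inverse (real (Suc k)) < \<epsilon>" using reals_Archimedean[OF \<epsilon>] by blast
    from q(1)[of "Suc k"] show ?thesis
      by (rule eventually_mono) (use k in \<open>auto intro: good_mono simp: inverse_eq_divide\<close>)
  qed
  define x where "x n = fst (fst (q n))" for n
  define \<xi> where "\<xi> n = snd (fst (q n))" for n
  define y where "y n = fst (snd (q n))" for n
  define \<eta> where "\<eta> n = snd (snd (q n))" for n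
  have good: "good \<epsilon> n (q n) \<longleftrightarrow> ndist X z (x n) < \<epsilon> \<and> ndist X z (y n) < \<epsilon> \<and>
      ereal (a - \<epsilon>) < fs n (x n) + ereal (\<phi> n (y n)) \<and>
      fs n (x n) + ereal (\<phi> n (y n)) < ereal (a + \<epsilon>) \<and>
      ereal (dual_norm X (\<lambda>u. \<xi> n u + \<eta> n u)) \<le> slope X f z + ereal \<epsilon>" for \<epsilon> n
    by (simp add: good_def x_def \<xi>_def y_def \<eta>_def case_prod_beta)
  have graph: "(x n, \<xi> n) \<in> subdiff_graph D X (fs n)" "(y n, \<eta> n) \<in> subdiff_graph D X (ext X (\<phi> n))" for n
    using q(2)[of n] by (auto simp: subgradient_pairs_def x_def \<xi>_def y_def \<eta>_def mem_Times_iff)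
  then have car: "x n \<in> carrier X" "y n \<in> carrier X" for n
    by (auto simp: subdiff_graph_def)
  have "limitin (ntop X) x z sequentially" "limitin (ntop X) y z sequentially"
    unfolding limitin_ntop[OF X]
    using z(1) car by (auto simp: M.commute[of _ z] intro: eventually_mono[OF ev] simp: good)
  moreover have "(\<lambda>n. fs n (x n) + ereal (\<phi> n (y n))) \<longlonglongrightarrow> f z"
  proof (rule order_tendstoI)
    fix b assume "b < f z"
    then obtain t where t: "b < ereal t" "ereal t < ereal a" unfolding a using ereal_dense2 by blast
    from t(2) have "0 < a - t" by simp
    from ev[OF this] show "\<forall>\<^sub>F n in sequentially. b < fs n (x n) + ereal (\<phi> n (y n))"
      by (rule eventually_mono) (use t in \<open>auto simp: good intro: less_trans\<close>)
  next
    fix b assume "f z < b"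
    then obtain t where t: "ereal a < ereal t" "ereal t < b" unfolding a using ereal_dense2 by blast
    from t(1) have "0 < t - a" by simp
    from ev[OF this] show "\<forall>\<^sub>F n in sequentially. fs n (x n) + ereal (\<phi> n (y n)) < b"
      by (rule eventually_mono) (use t in \<open>auto simp: good intro: less_trans\<close>)
  qed
  moreover have "limsup (\<lambda>n. ereal (dual_norm X (\<lambda>u. \<xi> n u + \<eta> n u))) \<le> slope X f z"
  proof (rule ereal_le_epsilon2)
    fix \<epsilon> :: real assume "0 < \<epsilon>"
    from ev[OF this] show "limsup (\<lambda>n. ereal (dual_norm X (\<lambda>u. \<xi> n u + \<eta> n u))) \<le> slope X f z + ereal \<epsilon>"
      by (intro Limsup_bounded) (auto simp: good elim: eventually_mono)
  qed
  ultimately show ?thesis using graph by blast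
qed

end
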